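(* Let $p$ be a prime and let $w=(a_n)_{n=1}^\infty$ be an infinite word on the alphabet $\{0,1,\dots,p-1\}$ for which there are a sequence $(w_j)_{j=1}^\infty$ of finite non-empty words on this alphabet, with $m_j=|w_j|$, and a sequence of positive real numbers $(\delta_j)_{j=1}^\infty$ such that for every $j$ the word $w_jw_j^{\delta_j}$ occurs as a subword in $w$. Let $(\ell_j)_{j=1}^\infty$ be a sequence of natural numbers satisfying, for every $j$, $$p^{\ell_j-1}\le \frac{p^{m_j}-1}{\gcd\left(p^{m_j}-1,(w_j)_p^+\right)}\le p^{\ell_j}.$$ If $\lim_{j\to\infty}\left(m_j+\lfloor m_j\delta_j\rfloor-2\ell_j\right)=\infty$, then the real number $w_p=\sum_{n=1}^\infty a_np^{-n}$ satisfies the $p$-adic Littlewood conjecture.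
   Context: Words: subwords are blocks of consecutive letters; $|v|$ denotes the length of a word $v$; juxtaposition denotes concatenation. For a finite non-empty word $v$ and a real $\delta>0$, $v^{\delta}$ denotes the prefix of length $\lfloor\delta\cdot|v|\rfloor$ of the periodic infinite word $vvv\cdots$ (so for $\delta<1$ it is the prefix of $v$ of that length). For a finite non-empty word $v=b_1b_2\cdots b_m$ on $\{0,1,\dots,p-1\}$, $v_p^+=\sum_{i=1}^m b_ip^{m-i}$ is the non-negative integer whose base-$p$ digits are given by $v$ (leading zeros allowed). The convention $\gcd(N,0)=N$ is used. A real number $x$ satisfies the $p$-adic Littlewood conjecture (pLC) if $\liminf_{q\to\infty} q\cdot|q|_p\cdot\|qx\|=0$, where $q$ runs over the positive integers, $|\cdot|_p$ is the $p$-adic absolute value and $\|\cdot\|$ is the distance to the nearest integer. *)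

theory Defs
  imports Complex_Main "HOL-Library.Extended_Real" "HOL-Computational_Algebra.Primes"
begin

text \<open>
  Finite words are lists of natural numbers. Infinite words are functions on \<open>nat\<close>, indexed
  from 1; the value at 0 is ignored.
\<close>

definition word_powr :: "'a list \<Rightarrow> real \<Rightarrow> 'a list" where
  "word_powr v \<delta> = map (\<lambda>i. v ! (i mod length v)) [0..<nat \<lfloor>\<delta> * real (length v)\<rfloor>]"

definition subword_of :: "'a list \<Rightarrow> (nat \<Rightarrow> 'a) \<Rightarrow> bool" where
  "subword_of u a \<longleftrightarrow> (\<exists>k\<ge>1. \<forall>i<length u. a (k + i) = u ! i)"

text \<open>Letters are numbered from 1 in the sum, whereas \<open>(!)\<close> counts from 0.\<close>

definition word_value :: "nat \<Rightarrow> nat list \<Rightarrow> nat" where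
  "word_value p v = (\<Sum>i = 1..length v. v ! (i - 1) * p ^ (length v - i))"

definition padic_abs :: "nat \<Rightarrow> int \<Rightarrow> real" where
  "padic_abs p q = (if q = 0 then 0 else 1 / real p ^ multiplicity (int p) q)"

definition dist_nearest_int :: "real \<Rightarrow> real" where
  "dist_nearest_int x = \<bar>x - of_int (round x)\<bar>"

text \<open>The value at \<open>q = 0\<close> does not affect the lower limit.\<close>

definition padic_Littlewood :: "nat \<Rightarrow> real \<Rightarrow> bool" where
  "padic_Littlewood p x \<longleftrightarrow>
     liminf (\<lambda>q::nat. ereal (real q * padic_abs p (int q) * dist_nearest_int (real q * x))) = 0"

end

theory Submission
  imports Defs
begin

text \<open>
  Suppose \<open>w w\<^sup>\<delta>\<close>, of length \<open>N\<close>, occurs in the expansion of \<open>x\<close> after \<open>e\<close> letters. Then the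
  fractional part of \<open>p\<^sup>e x\<close> lies within \<open>p\<^sup>-\<^sup>N\<close> of the number with periodic expansion \<open>w w w \<dots>\<close>, a
  fraction of denominator \<open>D = (p\<^sup>m - 1) / gcd (p\<^sup>m - 1, w\<^sup>+)\<close>. For \<open>q = D p\<^sup>e\<close> this gives
  \<open>q |q|\<^sub>p \<parallel>q x\<parallel> \<le> D\<^sup>2 p\<^sup>-\<^sup>N\<close>, which is small when \<open>N - 2 l\<close> is large. The values of \<open>q\<close> obtained
  are unbounded unless some \<open>q x\<close> is an integer, and then all multiples of
  that \<open>q\<close> give the value \<open>0\<close>.
\<close>

section \<open>Base-\<open>p\<close> expansions and their shifts\<close>

text \<open>Digits are counted from \<open>0\<close>, so that dropping the first \<open>k\<close> of
  them is the plain shift \<open>d (n + k)\<close>; the number of the theorem has digits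
  \<open>a (Suc n)\<close>.\<close>

definition expansion :: "nat \<Rightarrow> (nat \<Rightarrow> nat) \<Rightarrow> real" where
  "expansion p d = (\<Sum>n. real (d n) / real p ^ Suc n)"

text \<open>The common majorant of all expansions: it gives both their convergence and the bound by
  \<open>1\<close>.\<close>

lemma sums_max_digit:
  assumes "p \<ge> 2"
  shows "(\<lambda>n. real (p - 1) / real p ^ Suc n) sums 1"
proof -
  have "(\<lambda>n. real (p - 1) / real p * (1 / real p) ^ n)
          sums (real (p - 1) / real p * (1 / (1 - 1 / real p)))"
    using assms by (intro sums_mult geometric_sums) simp
  moreover have "real (p - 1) / real p * (1 / (1 - 1 / real p)) = 1"
    using assms by (simp add: field_simps of_nat_diff)
  moreover have "real (p - 1) / real p * (1 / real p) ^ n = real (p - 1) / real p ^ Suc n" for n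
    by (simp add: power_one_over)
  ultimately show ?thesis by (simp only:)
qed

lemma digit_le_max:
  assumes "d < p"
  shows "real d / real p ^ Suc n \<le> real (p - 1) / real p ^ Suc n"
  using assms by (intro divide_right_mono) auto

lemma summable_expansion:
  assumes "p \<ge> 2" "\<And>n. d n < p"
  shows "summable (\<lambda>n. real (d n) / real p ^ Suc n)"
proof (rule summable_comparison_test')
  show "summable (\<lambda>n. real (p - 1) / real p ^ Suc n)"
    using sums_max_digit[OF assms(1)] by (rule sums_summable)
  show "norm (real (d n) / real p ^ Suc n) \<le> real (p - 1) / real p ^ Suc n" for n
    using digit_le_max[OF assms(2)] by simp
qed

lemma expansion_bounds:
  assumes "p \<ge> 2" "\<And>n. d n < p"
  shows "0 \<le> expansion p d" "expansion p d \<le> 1"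
proof -
  note summable = summable_expansion[OF assms]
  show "0 \<le> expansion p d"
    unfolding expansion_def by (intro suminf_nonneg summable) simp
  have "expansion p d \<le> (\<Sum>n. real (p - 1) / real p ^ Suc n)"
    unfolding expansion_def
    by (intro suminf_le digit_le_max assms(2) summable
        sums_summable[OF sums_max_digit[OF assms(1)]])
  also have "\<dots> = 1"
    using sums_max_digit[OF assms(1)] by (rule sums_unique[symmetric])
  finally show "expansion p d \<le> 1" .
qed

text \<open>Multiplying by \<open>p ^ k\<close> moves the point \<open>k\<close> places: the first
  \<open>k\<close> digits form an integer and the tail is again an expansion.\<close>

lemma expansion_shift:
  assumes "p \<ge> 2" "\<And>n. d n < p"
  shows "real p ^ k * expansion p d
           = real (\<Sum>i<k. d i * p ^ (k - Suc i)) + expansion p (\<lambda>n. d (n + k))"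
proof -
  let ?f = "\<lambda>n. real (d n) / real p ^ Suc n"
  have p0: "real p \<noteq> 0" using assms(1) by simp
  have "expansion p d = (\<Sum>n. ?f (n + k)) + sum ?f {..<k}"
    unfolding expansion_def by (rule suminf_split_initial_segment[OF summable_expansion[OF assms]])
  moreover have "real p ^ k * (\<Sum>n. ?f (n + k)) = expansion p (\<lambda>n. d (n + k))"
  proof -
    have "real p ^ k * (\<Sum>n. ?f (n + k)) = (\<Sum>n. real p ^ k * ?f (n + k))"
      by (rule suminf_mult[symmetric])
        (rule summable_ignore_initial_segment[OF summable_expansion[OF assms]])
    also have "\<dots> = expansion p (\<lambda>n. d (n + k))"
      unfolding expansion_def using p0 by (simp add: power_add)
    finally show ?thesis .
  qed
  moreover have "real p ^ k * sum ?f {..<k} = real (\<Sum>i<k. d i * p ^ (k - Suc i))"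
  proof -
    have "real p ^ k * ?f i = real (d i) * real p ^ (k - Suc i)" if "i < k" for i
    proof -
      have "real p ^ k = real p ^ (k - Suc i) * real p ^ Suc i"
        using that by (simp flip: power_add power_Suc)
      then show ?thesis using p0 by simp
    qed
    then show ?thesis by (simp add: sum_distrib_left)
  qed
  ultimately show ?thesis by (simp add: algebra_simps)
qed

text \<open>After multiplication by \<open>p ^ N\<close> the equal integer parts cancel, which
  leaves a difference of two numbers in the interval from \<open>0\<close> to
  \<open>1\<close>.\<close>

lemma expansion_diff_le:
  assumes "p \<ge> 2" "\<And>n. d n < p" "\<And>n. c n < p" "\<And>i. i < N \<Longrightarrow> d i = c i"
  shows "\<bar>expansion p d - expansion p c\<bar> \<le> 1 / real p ^ N"
proof -
  have "(\<Sum>i<N. d i * p ^ (N - Suc i)) = (\<Sum>i<N. c i * p ^ (N - Suc i))"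
    using assms(4) by simp
  then have "real p ^ N * (expansion p d - expansion p c)
      = expansion p (\<lambda>n. d (n + N)) - expansion p (\<lambda>n. c (n + N))"
    using expansion_shift[OF assms(1), of d N] expansion_shift[OF assms(1), of c N] assms(2,3)
    by (simp add: algebra_simps)
  moreover have "\<bar>\<dots>\<bar> \<le> 1"
    using expansion_bounds[OF assms(1), of "\<lambda>n. d (n + N)"]
      expansion_bounds[OF assms(1), of "\<lambda>n. c (n + N)"] assms(2,3) by force
  ultimately have "\<bar>real p ^ N * (expansion p d - expansion p c)\<bar> \<le> 1" by simp
  then have "real p ^ N * \<bar>expansion p d - expansion p c\<bar> \<le> 1"
    by (simp add: abs_mult)
  then show ?thesis
    using assms(1) by (simp add: pos_le_divide_eq mult.commute)
qed

section \<open>Periodic words\<close>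

lemma nth_mod_length_less:
  assumes "v \<noteq> []" "set v \<subseteq> {0..<p}"
  shows "v ! (i mod length v) < p"
proof -
  have "v ! (i mod length v) \<in> set v" using assms(1) by simp
  then show ?thesis using assms(2) by auto
qed

text \<open>Shifting by one whole period reproduces the digits, so the value \<open>X\<close> solves
  \<open>p ^ length v * X = word_value p v + X\<close>.\<close>

lemma expansion_periodic:
  assumes "p \<ge> 2" "v \<noteq> []" "set v \<subseteq> {0..<p}"
  shows "real (p ^ length v - 1) * expansion p (\<lambda>i. v ! (i mod length v)) = real (word_value p v)"
proof -
  let ?c = "\<lambda>i. v ! (i mod length v)" and ?m = "length v"
  from expansion_shift[OF assms(1) nth_mod_length_less[OF assms(2,3)], of ?m "\<lambda>i. i"]
  have "real p ^ ?m * expansion p ?c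
      = real (\<Sum>i<?m. ?c i * p ^ (?m - Suc i)) + expansion p ?c"
    by (simp only: mod_add_self2)
  moreover have "(\<Sum>i<?m. ?c i * p ^ (?m - Suc i)) = word_value p v"
    unfolding word_value_def by (simp add: sum.atLeast1_atMost_eq)
  moreover have "real (p ^ ?m - 1) = real p ^ ?m - 1"
    using assms(1) by (simp add: of_nat_diff)
  ultimately show ?thesis by (simp only: left_diff_distrib)
qed

lemma length_word_powr [simp]: "length (word_powr v \<delta>) = nat \<lfloor>\<delta> * real (length v)\<rfloor>"
  by (simp add: word_powr_def)

lemma nth_append_word_powr:
  assumes "i < length (v @ word_powr v \<delta>)"
  shows "(v @ word_powr v \<delta>) ! i = v ! (i mod length v)"
proof (cases "i < length v")
  case False
  then have "(i - length v) mod length v = i mod length v"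
    by (simp add: le_mod_geq)
  moreover have "i - length v < nat \<lfloor>\<delta> * real (length v)\<rfloor>"
    using False assms by simp
  ultimately show ?thesis
    using False by (simp add: nth_append word_powr_def)
qed (simp add: nth_append)

section \<open>The product in the Littlewood condition and its lower limit\<close>

lemma dist_nearest_int_le: "dist_nearest_int x \<le> \<bar>x - of_int n\<bar>"
  unfolding dist_nearest_int_def using round_diff_minimal[of x n] by (simp add: abs_minus_commute)

lemma padic_abs_nonneg: "0 \<le> padic_abs p q"
  by (simp add: padic_abs_def)

text \<open>Only an inequality, because \<open>q\<close> may contain further factors
  \<open>p\<close>.\<close>

lemma padic_abs_mult_power_le:
  assumes "p \<ge> 2"
  shows "padic_abs p (q * int p ^ e) \<le> 1 / real p ^ e"
proof (cases "q = 0")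
  case False
  then have "e \<le> multiplicity (int p) (q * int p ^ e)"
    using assms by (intro multiplicity_geI) auto
  then have "real p ^ e \<le> real p ^ multiplicity (int p) (q * int p ^ e)"
    using assms by (intro power_increasing) auto
  then show ?thesis
    using assms False by (auto simp: padic_abs_def intro!: divide_left_mono)
qed (simp add: padic_abs_def)

definition padic_product :: "nat \<Rightarrow> real \<Rightarrow> nat \<Rightarrow> real" where
  "padic_product p x q = real q * padic_abs p (int q) * dist_nearest_int (real q * x)"

lemma padic_product_nonneg: "0 \<le> padic_product p x q"
  by (simp add: padic_product_def padic_abs_nonneg dist_nearest_int_def)

text \<open>The first two factors are positive for \<open>q > 0\<close>, so the product vanishes
  only if \<open>q * x\<close> is an integer, and this passes to multiples.\<close>

lemma padic_product_eq_0_mult: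
  assumes "p > 0" "q > 0" "padic_product p x q = 0"
  shows "padic_product p x (n * q) = 0"
proof -
  have "real q * x = of_int (round (real q * x))"
    using assms by (auto simp: padic_product_def padic_abs_def dist_nearest_int_def)
  then have "real (n * q) * x = of_int (int n * round (real q * x))"
    by (simp add: mult.assoc)
  then have "dist_nearest_int (real (n * q) * x) = 0"
    unfolding dist_nearest_int_def by (metis abs_zero diff_self round_of_int)
  then show ?thesis by (simp add: padic_product_def)
qed

lemma padic_Littlewood_if_arbitrarily_small:
  assumes "p > 0" and small: "\<And>\<epsilon>. \<epsilon> > 0 \<Longrightarrow> \<exists>q>0. padic_product p x q < \<epsilon>"
  shows "padic_Littlewood p x"
proof -
  have frequently: "\<exists>q\<ge>Q. padic_product p x q < \<epsilon>" if "\<epsilon> > 0" for \<epsilon> Q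
  proof (cases "\<exists>q>0. padic_product p x q = 0")
    case True
    then obtain q where q: "q > 0" "padic_product p x q = 0" by blast
    have "padic_product p x (Q * q) = 0"
      by (rule padic_product_eq_0_mult[OF assms(1) q])
    then show ?thesis
      using q that by (intro exI[of _ "Q * q"]) auto
  next
    case False
    \<comment> \<open>Lying below all the finitely many positive values up to \<open>Q\<close>
      forces a denominator beyond \<open>Q\<close>. Inserting \<open>\<epsilon>\<close> also keeps
      the set non-empty when \<open>Q = 0\<close>.\<close>
    define \<epsilon>' where "\<epsilon>' = Min (insert \<epsilon> (padic_product p x ` {1..Q}))"
    have "padic_product p x q > 0" if "q \<in> {1..Q}" for q
      using False padic_product_nonneg[of p x q] that
      by (metis atLeastAtMost_iff less_eq_real_def less_numeral_extra(1) order_less_le_trans)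
    then have "\<epsilon>' > 0"
      unfolding \<epsilon>'_def using that by simp
    from small[OF this] obtain q where q: "q > 0" "padic_product p x q < \<epsilon>'" by blast
    have "q > Q"
    proof (rule ccontr)
      assume "\<not> q > Q"
      then have "\<epsilon>' \<le> padic_product p x q"
        unfolding \<epsilon>'_def using q by (intro Min_le) auto
      with q show False by simp
    qed
    moreover have "\<epsilon>' \<le> \<epsilon>" unfolding \<epsilon>'_def by (intro Min_le) auto
    ultimately show ?thesis using q by (intro exI[of _ q]) auto
  qed
  have "liminf (\<lambda>q. ereal (padic_product p x q)) = 0"
  proof (rule antisym)
    show "0 \<le> liminf (\<lambda>q. ereal (padic_product p x q))"
      by (rule Liminf_bounded) (simp add: padic_product_nonneg)
    show "liminf (\<lambda>q. ereal (padic_product p x q)) \<le> 0"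
    proof (rule ereal_le_epsilon2)
      fix \<epsilon> :: real assume "\<epsilon> > 0"
      have "(INF q\<in>{Q..}. ereal (padic_product p x q)) \<le> ereal \<epsilon>" for Q
      proof -
        obtain q where "q \<ge> Q" "padic_product p x q < \<epsilon>"
          using frequently[OF \<open>\<epsilon> > 0\<close>] by blast
        then show ?thesis by (intro INF_lower2[of q]) auto
      qed
      then show "liminf (\<lambda>q. ereal (padic_product p x q)) \<le> 0 + ereal \<epsilon>"
        by (auto simp: liminf_SUP_INF intro!: SUP_least)
    qed
  qed
  then show ?thesis by (simp add: padic_Littlewood_def padic_product_def)
qed

section \<open>The denominator obtained from one repetition\<close>

lemma padic_product_le_of_subword:
  fixes a :: "nat \<Rightarrow> nat"
  assumes p: "p \<ge> 2" and a: "\<And>n. n \<ge> 1 \<Longrightarrow> a n < p"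
    and v: "v \<noteq> []" "set v \<subseteq> {0..<p}"
    and sub: "subword_of (v @ word_powr v \<delta>) a"
  defines "D \<equiv> (p ^ length v - 1) div gcd (p ^ length v - 1) (word_value p v)"
  shows "\<exists>q>0. padic_product p (expansion p (\<lambda>n. a (Suc n))) q
           \<le> real D ^ 2 / real p ^ length (v @ word_powr v \<delta>)"
proof -
  let ?m = "length v" and ?N = "length (v @ word_powr v \<delta>)" and ?x = "expansion p (\<lambda>n. a (Suc n))"
  define g where "g = gcd (p ^ ?m - 1) (word_value p v)"
  have "p ^ ?m > 1" using p v by (intro one_less_power) auto
  then have g: "g > 0" and D: "p ^ ?m - 1 = D * g" "D > 0"
    unfolding D_def g_def by (auto simp: div_greater_zero_iff gcd_le1_nat)
  obtain h where h: "word_value p v = g * h"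
    unfolding g_def by (meson dvdE gcd_dvd2)
  obtain k where k: "k \<ge> 1" "\<And>i. i < ?N \<Longrightarrow> a (k + i) = (v @ word_powr v \<delta>) ! i"
    using sub unfolding subword_of_def by blast
  \<comment> \<open>Letters are numbered from \<open>1\<close>, so \<open>k - 1\<close> of them
    precede the occurrence.\<close>
  define e where "e = k - 1"
  define y where "y = expansion p (\<lambda>n. a (Suc (n + e)))"
  define c where "c i = v ! (i mod ?m)" for i
  have c: "c i < p" for i
    unfolding c_def using v by (rule nth_mod_length_less)
  have "a (Suc (i + e)) = c i" if "i < ?N" for i
    using k(2)[OF that] nth_append_word_powr[OF that] k(1) by (simp add: e_def c_def add.commute)
  then have y: "\<bar>y - expansion p c\<bar> \<le> 1 / real p ^ ?N"
    unfolding y_def using p a c by (intro expansion_diff_le) auto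
  \<comment> \<open>Both \<open>p ^ ?m - 1\<close> and \<open>word_value p v\<close> are multiples
    of \<open>g\<close>; cancelling it shows that \<open>D\<close> already clears the denominator of
    the periodic number.\<close>
  have "real g * (real D * expansion p c) = real g * real h"
    using expansion_periodic[OF p v] unfolding D h c_def[abs_def] by (simp add: ac_simps)
  then have Dc: "real D * expansion p c = real h" using g by simp
  define q where "q = D * p ^ e"
  obtain A :: nat where A: "real p ^ e * ?x = real A + y"
    using expansion_shift[OF p, of "\<lambda>n. a (Suc n)" e] a unfolding y_def by (metis le_add1 plus_1_eq_Suc)
  have "real q * ?x = real D * (real A + y)"
    unfolding A[symmetric] q_def by simp
  \<comment> \<open>\<open>D * A + h\<close> is the integer obtained when \<open>y\<close> is
    replaced by the periodic number \<open>expansion p c\<close>.\<close>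
  then have "real q * ?x - of_int (int (D * A + h)) = real D * (y - expansion p c)"
    using Dc by (simp add: algebra_simps)
  then have "dist_nearest_int (real q * ?x) \<le> real D * \<bar>y - expansion p c\<bar>"
    using dist_nearest_int_le[of "real q * ?x" "int (D * A + h)"] by (simp add: abs_mult)
  also have "\<dots> \<le> real D * (1 / real p ^ ?N)"
    by (intro mult_left_mono y) simp
  finally have dist: "dist_nearest_int (real q * ?x) \<le> real D * (1 / real p ^ ?N)" .
  \<comment> \<open>The \<open>p\<close>-adic absolute value absorbs \<open>p ^ e\<close>, so the
    position of the occurrence does not enter the bound. One factor \<open>D\<close> remains here;
    the other comes from the distance.\<close>
  have "real q * padic_abs p (int q) \<le> real q * (1 / real p ^ e)"
    unfolding q_def using padic_abs_mult_power_le[OF p, of "int D" e]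
    by (intro mult_left_mono) auto
  also have "\<dots> = real D" using p by (simp add: q_def)
  finally have "padic_product p ?x q \<le> real D * (real D * (1 / real p ^ ?N))"
    unfolding padic_product_def using dist
    by (intro mult_mono) (auto simp: dist_nearest_int_def)
  moreover have "q > 0" using D p by (simp add: q_def)
  ultimately show ?thesis by (intro exI[of _ q]) (simp add: power2_eq_square)
qed

theorem theorem2p3:
  fixes p :: nat and a :: "nat \<Rightarrow> nat" and w :: "nat \<Rightarrow> nat list"
    and m l :: "nat \<Rightarrow> nat" and \<delta> :: "nat \<Rightarrow> real"
  assumes "prime p"
    and "\<And>n. n \<ge> 1 \<Longrightarrow> a n < p"
    and "\<And>j. j \<ge> 1 \<Longrightarrow> w j \<noteq> []"
    and "\<And>j. j \<ge> 1 \<Longrightarrow> set (w j) \<subseteq> {0..<p}"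
    and "\<And>j. j \<ge> 1 \<Longrightarrow> m j = length (w j)"
    and "\<And>j. j \<ge> 1 \<Longrightarrow> \<delta> j > 0"
    and "\<And>j. j \<ge> 1 \<Longrightarrow> subword_of (w j @ word_powr (w j) (\<delta> j)) a"
    and "\<And>j. j \<ge> 1 \<Longrightarrow>
           real p powi (int (l j) - 1)
             \<le> real (p ^ m j - 1) / real (gcd (p ^ m j - 1) (word_value p (w j)))"
    and "\<And>j. j \<ge> 1 \<Longrightarrow>
           real (p ^ m j - 1) / real (gcd (p ^ m j - 1) (word_value p (w j))) \<le> real p ^ l j"
    and "filterlim (\<lambda>j. int (m j) + \<lfloor>real (m j) * \<delta> j\<rfloor> - 2 * int (l j)) at_top sequentially"
  shows "padic_Littlewood p (\<Sum>n. real (a (Suc n)) / real p ^ Suc n)"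
proof -
  have p: "p \<ge> 2" using assms(1) by (rule prime_ge_2_nat)
  let ?x = "expansion p (\<lambda>n. a (Suc n))"
  have "padic_Littlewood p ?x"
  proof (rule padic_Littlewood_if_arbitrarily_small)
    fix \<epsilon> :: real assume "\<epsilon> > 0"
    obtain t where t: "1 / real p ^ t < \<epsilon>"
      using real_arch_pow_inv[OF \<open>\<epsilon> > 0\<close>, of "1 / real p"] p by (auto simp: power_one_over)
    have "\<forall>\<^sub>F j in sequentially. int t \<le> int (m j) + \<lfloor>real (m j) * \<delta> j\<rfloor> - 2 * int (l j)"
      using assms(10) by (simp add: filterlim_at_top)
    then have "\<forall>\<^sub>F j in sequentially. j \<ge> 1
        \<and> int t \<le> int (m j) + \<lfloor>real (m j) * \<delta> j\<rfloor> - 2 * int (l j)"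
      by (intro eventually_conj eventually_ge_at_top)
    then obtain j where j: "j \<ge> 1"
      and le: "int t \<le> int (m j) + \<lfloor>real (m j) * \<delta> j\<rfloor> - 2 * int (l j)"
      by (auto dest: eventually_happens)
    let ?N = "length (w j @ word_powr (w j) (\<delta> j))"
    define D where "D = (p ^ length (w j) - 1) div gcd (p ^ length (w j) - 1) (word_value p (w j))"
    \<comment> \<open>The length of \<open>word_powr\<close> is \<open>nat\<close> of the floor,
      which is never less than the floor itself.\<close>
    have N: "t + 2 * l j \<le> ?N"
      using le assms(5)[OF j] by (simp add: mult.commute)
    \<comment> \<open>The gcd divides exactly, so \<open>div\<close> agrees with the real quotient
      in the hypothesis.\<close>
    have "real D \<le> real p ^ l j"
      using assms(9)[OF j] assms(5)[OF j] by (simp add: D_def real_of_nat_div)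
    then have "real D ^ 2 \<le> (real p ^ l j) ^ 2" by (intro power_mono) auto
    also have "\<dots> = real p ^ (2 * l j)" by (simp add: power_mult[symmetric] mult.commute)
    finally have "real D ^ 2 / real p ^ ?N \<le> real p ^ (2 * l j) / real p ^ (t + 2 * l j)"
      using p by (intro frac_le power_increasing N) auto
    also have "\<dots> = 1 / real p ^ t" using p by (simp add: power_add)
    finally have "real D ^ 2 / real p ^ ?N < \<epsilon>" using t by simp
    moreover obtain q where "q > 0" "padic_product p ?x q \<le> real D ^ 2 / real p ^ ?N"
      using padic_product_le_of_subword[OF p assms(2) assms(3,4,7)[OF j]] unfolding D_def by blast
    ultimately show "\<exists>q>0. padic_product p ?x q < \<epsilon>" by force
  qed (use p in simp)
  then show ?thesis by (simp add: expansion_def)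
qed

end
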